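(* The variety $\mathcal V$ of I-algebras is $3$-permutable, congruence distributive and weakly regular (with respect to the constant $1$).
   Context: An I-algebra is an algebra $(A,\vee,r,\rightarrow,1)$ of type $(2,3,2,0)$ such that $(A,\vee,1)$ is a join-semilattice with top element $1$ (ordered by $x\leq y$ iff $x\vee y=y$) and for all $x,y,z,u\in A$: (1') $y\leq x\rightarrow y$; (2') $r(x,x\rightarrow y,y)=y$; (3') $(x\vee y)\rightarrow y=x\rightarrow y$; (4') $y\leq(x\vee z)\rightarrow r(x,y,z)$; (5') $r(x,y,z)\leq x\vee z$; (6') $r(x,y,z)\leq y\vee z$; (7') $r(x,x\vee y,z)=x\vee z$; (8') $r(x,y,z)=r(x\vee z,y\vee z,z)$; (9') $z\leq r(x,y,z)$; (10') $r(u,r(x,y,z),z)=r(r(u,x,z),r(u,y,z),z)$. Since the inequalities are expressible as identities, the class $\mathcal V$ of all I-algebras is a variety. An algebra $\mathbf A$ with set of congruences $\operatorname{Con}\mathbf A$ is called $3$-permutable if $\Theta\circ\Phi\circ\Theta=\Phi\circ\Theta\circ\Phi$ for all $\Theta,\Phi\in\operatorname{Con}\mathbf A$; congruence distributive if its congruence lattice is distributive; and, if it has an equationally definable constant $1$, weakly regular if $\Theta,\Phi\in\operatorname{Con}\mathbf A$ and $[1]\Theta=[1]\Phi$ imply $\Theta=\Phi$, where $[1]\Theta$ is the $\Theta$-class of $1$. A variety has one of these properties if each of its members does. *)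

theory Defs
  imports "HOL-Algebra.Lattice"
begin

text \<open>Algebras of type (2,3,2,0): \<open>x \<curlyvee> y\<close> is the join, \<open>tern\<close> the ternary operation \<open>r\<close>,
  \<open>x \<leadsto> y\<close> the implication and \<open>unt\<close> the constant 1. (The symbols \<open>\<squnion>\<close>, \<open>\<sqinter>\<close>, \<open>\<sqsubseteq>\<close> are those of
  HOL-Algebra and are used for lattices of congruences.)\<close>

record 'a alg2320 = "'a partial_object" +
  ajoin :: "'a \<Rightarrow> 'a \<Rightarrow> 'a" (infixl \<open>\<curlyvee>\<index>\<close> 65)
  tern :: "'a \<Rightarrow> 'a \<Rightarrow> 'a \<Rightarrow> 'a" (\<open>\<^bold>r\<index>\<close>)
  aimp :: "'a \<Rightarrow> 'a \<Rightarrow> 'a" (infixr \<open>\<leadsto>\<index>\<close> 60)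
  unt :: 'a (\<open>\<one>\<index>\<close>)

definition ale :: "('a, 'b) alg2320_scheme \<Rightarrow> 'a \<Rightarrow> 'a \<Rightarrow> bool" (infix \<open>\<preceq>\<index>\<close> 50)
  where "x \<preceq>\<^bsub>A\<^esub> y \<longleftrightarrow> x \<curlyvee>\<^bsub>A\<^esub> y = y"

locale algebra2320 =
  fixes A (structure)
  assumes join_closed: "\<lbrakk>x \<in> carrier A; y \<in> carrier A\<rbrakk> \<Longrightarrow> x \<curlyvee> y \<in> carrier A"
    and tern_closed: "\<lbrakk>x \<in> carrier A; y \<in> carrier A; z \<in> carrier A\<rbrakk> \<Longrightarrow> \<^bold>r x y z \<in> carrier A"
    and imp_closed: "\<lbrakk>x \<in> carrier A; y \<in> carrier A\<rbrakk> \<Longrightarrow> x \<leadsto> y \<in> carrier A"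
    and one_closed: "\<one> \<in> carrier A"

locale I_algebra = algebra2320 +
  assumes join_assoc: "\<lbrakk>x \<in> carrier A; y \<in> carrier A; z \<in> carrier A\<rbrakk>
      \<Longrightarrow> (x \<curlyvee> y) \<curlyvee> z = x \<curlyvee> (y \<curlyvee> z)"
    and join_comm: "\<lbrakk>x \<in> carrier A; y \<in> carrier A\<rbrakk> \<Longrightarrow> x \<curlyvee> y = y \<curlyvee> x"
    and join_idem: "x \<in> carrier A \<Longrightarrow> x \<curlyvee> x = x"
    and le_one: "x \<in> carrier A \<Longrightarrow> x \<preceq> \<one>"
    and I1: "\<lbrakk>x \<in> carrier A; y \<in> carrier A\<rbrakk> \<Longrightarrow> y \<preceq> x \<leadsto> y"
    and I2: "\<lbrakk>x \<in> carrier A; y \<in> carrier A\<rbrakk> \<Longrightarrow> \<^bold>r x (x \<leadsto> y) y = y"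
    and I3: "\<lbrakk>x \<in> carrier A; y \<in> carrier A\<rbrakk> \<Longrightarrow> (x \<curlyvee> y) \<leadsto> y = x \<leadsto> y"
    and I4: "\<lbrakk>x \<in> carrier A; y \<in> carrier A; z \<in> carrier A\<rbrakk> \<Longrightarrow> y \<preceq> (x \<curlyvee> z) \<leadsto> \<^bold>r x y z"
    and I5: "\<lbrakk>x \<in> carrier A; y \<in> carrier A; z \<in> carrier A\<rbrakk> \<Longrightarrow> \<^bold>r x y z \<preceq> x \<curlyvee> z"
    and I6: "\<lbrakk>x \<in> carrier A; y \<in> carrier A; z \<in> carrier A\<rbrakk> \<Longrightarrow> \<^bold>r x y z \<preceq> y \<curlyvee> z"
    and I7: "\<lbrakk>x \<in> carrier A; y \<in> carrier A; z \<in> carrier A\<rbrakk> \<Longrightarrow> \<^bold>r x (x \<curlyvee> y) z = x \<curlyvee> z"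
    and I8: "\<lbrakk>x \<in> carrier A; y \<in> carrier A; z \<in> carrier A\<rbrakk>
      \<Longrightarrow> \<^bold>r x y z = \<^bold>r (x \<curlyvee> z) (y \<curlyvee> z) z"
    and I9: "\<lbrakk>x \<in> carrier A; y \<in> carrier A; z \<in> carrier A\<rbrakk> \<Longrightarrow> z \<preceq> \<^bold>r x y z"
    and I10: "\<lbrakk>x \<in> carrier A; y \<in> carrier A; z \<in> carrier A; u \<in> carrier A\<rbrakk>
      \<Longrightarrow> \<^bold>r u (\<^bold>r x y z) z = \<^bold>r (\<^bold>r u x z) (\<^bold>r u y z) z"

text \<open>The class of all I-algebras; being polymorphic in \<open>'a\<close>, it comprises the I-algebras on
  subsets of every type.\<close>

definition I_algebras :: "'a alg2320 set" (\<open>\<V>\<close>)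
  where "\<V> = {A. I_algebra A}"

definition Con :: "('a, 'b) alg2320_scheme \<Rightarrow> ('a \<times> 'a) set set"
  where "Con A = {\<Theta>. equiv (carrier A) \<Theta>
    \<and> (\<forall>(a, a') \<in> \<Theta>. \<forall>(b, b') \<in> \<Theta>. (a \<curlyvee>\<^bsub>A\<^esub> b, a' \<curlyvee>\<^bsub>A\<^esub> b') \<in> \<Theta>)
    \<and> (\<forall>(a, a') \<in> \<Theta>. \<forall>(b, b') \<in> \<Theta>. \<forall>(c, c') \<in> \<Theta>. (\<^bold>r\<^bsub>A\<^esub> a b c, \<^bold>r\<^bsub>A\<^esub> a' b' c') \<in> \<Theta>)
    \<and> (\<forall>(a, a') \<in> \<Theta>. \<forall>(b, b') \<in> \<Theta>. (a \<leadsto>\<^bsub>A\<^esub> b, a' \<leadsto>\<^bsub>A\<^esub> b') \<in> \<Theta>)}"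

definition Con_order :: "('a, 'b) alg2320_scheme \<Rightarrow> ('a \<times> 'a) set gorder"
  where "Con_order A = \<lparr>carrier = Con A, eq = (=), le = (\<subseteq>)\<rparr>"

definition distributive_lattice :: "('a, 'b) gorder_scheme \<Rightarrow> bool"
  where "distributive_lattice L \<longleftrightarrow> lattice L \<and>
    (\<forall>x \<in> carrier L. \<forall>y \<in> carrier L. \<forall>z \<in> carrier L.
      x \<sqinter>\<^bsub>L\<^esub> (y \<squnion>\<^bsub>L\<^esub> z) = (x \<sqinter>\<^bsub>L\<^esub> y) \<squnion>\<^bsub>L\<^esub> (x \<sqinter>\<^bsub>L\<^esub> z))"

definition three_permutable :: "('a, 'b) alg2320_scheme \<Rightarrow> bool"
  where "three_permutable A \<longleftrightarrow>
    (\<forall>\<Theta> \<in> Con A. \<forall>\<Phi> \<in> Con A. \<Theta> O \<Phi> O \<Theta> = \<Phi> O \<Theta> O \<Phi>)"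

definition congruence_distributive :: "('a, 'b) alg2320_scheme \<Rightarrow> bool"
  where "congruence_distributive A \<longleftrightarrow> distributive_lattice (Con_order A)"

definition weakly_regular :: "('a, 'b) alg2320_scheme \<Rightarrow> bool"
  where "weakly_regular A \<longleftrightarrow>
    (\<forall>\<Theta> \<in> Con A. \<forall>\<Phi> \<in> Con A. \<Theta> `` {\<one>\<^bsub>A\<^esub>} = \<Phi> `` {\<one>\<^bsub>A\<^esub>} \<longrightarrow> \<Theta> = \<Phi>)"

end

(* The identity r(x, x \<leadsto> y, y) = y recovers y from x \<leadsto> y, whereas r(x, 1, y) = x \<curlyvee> y. Hence, modulo a
   congruence, x \<leadsto> y \<equiv> 1 forces y \<equiv> x \<curlyvee> y; since x \<leadsto> x = 1, two elements x, y are congruent iff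
   x \<leadsto> y and y \<leadsto> x both lie in the class of 1. This is weak regularity.
   The term p(x,y,z) = r(z, y \<leadsto> x, x) satisfies p(x,z,z) = x and p(x,x,z) = z \<curlyvee> x = p(z,x,x), so
   p(x,y,z) and p(z,y,x) are Hagemann-Mitschke terms for 3-permutability, which makes the join of two
   congruences equal to \<Phi> O \<Psi> O \<Phi>. As r(x,u,x) = x for all u, a \<Theta>-related pair x, z turns any chain u_i
   from x to z into the chain r(x,u_i,z) from x \<curlyvee> z to z inside a single \<Theta>-class, and symmetrically
   into one from x to z \<curlyvee> x; this gives distributivity. *)

theory Submission
  imports Defs
begin

section \<open>Congruences\<close>

lemma ConI:
  assumes "equiv (carrier A) \<Theta>"
    and "\<And>a a' b b'. (a, a') \<in> \<Theta> \<Longrightarrow> (b, b') \<in> \<Theta> \<Longrightarrow> (a \<curlyvee>\<^bsub>A\<^esub> b, a' \<curlyvee>\<^bsub>A\<^esub> b') \<in> \<Theta>"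
    and "\<And>a a' b b' c c'. (a, a') \<in> \<Theta> \<Longrightarrow> (b, b') \<in> \<Theta> \<Longrightarrow> (c, c') \<in> \<Theta>
      \<Longrightarrow> (\<^bold>r\<^bsub>A\<^esub> a b c, \<^bold>r\<^bsub>A\<^esub> a' b' c') \<in> \<Theta>"
    and "\<And>a a' b b'. (a, a') \<in> \<Theta> \<Longrightarrow> (b, b') \<in> \<Theta> \<Longrightarrow> (a \<leadsto>\<^bsub>A\<^esub> b, a' \<leadsto>\<^bsub>A\<^esub> b') \<in> \<Theta>"
  shows "\<Theta> \<in> Con A"
  unfolding Con_def using assms by blast

lemma Con_equiv: "\<Theta> \<in> Con A \<Longrightarrow> equiv (carrier A) \<Theta>"
  by (simp add: Con_def)

lemma Con_join:
  "\<lbrakk>\<Theta> \<in> Con A; (a, a') \<in> \<Theta>; (b, b') \<in> \<Theta>\<rbrakk> \<Longrightarrow> (a \<curlyvee>\<^bsub>A\<^esub> b, a' \<curlyvee>\<^bsub>A\<^esub> b') \<in> \<Theta>"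
  unfolding Con_def by blast

lemma Con_tern:
  "\<lbrakk>\<Theta> \<in> Con A; (a, a') \<in> \<Theta>; (b, b') \<in> \<Theta>; (c, c') \<in> \<Theta>\<rbrakk>
    \<Longrightarrow> (\<^bold>r\<^bsub>A\<^esub> a b c, \<^bold>r\<^bsub>A\<^esub> a' b' c') \<in> \<Theta>"
  unfolding Con_def by blast

lemma Con_imp:
  "\<lbrakk>\<Theta> \<in> Con A; (a, a') \<in> \<Theta>; (b, b') \<in> \<Theta>\<rbrakk> \<Longrightarrow> (a \<leadsto>\<^bsub>A\<^esub> b, a' \<leadsto>\<^bsub>A\<^esub> b') \<in> \<Theta>"
  unfolding Con_def by blast

lemma Con_carrier:
  assumes "\<Theta> \<in> Con A" and "(a, b) \<in> \<Theta>"
  shows "a \<in> carrier A" and "b \<in> carrier A"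
  using equiv_type[OF Con_equiv[OF assms(1)]] assms(2) by auto

lemma Con_refl: "\<lbrakk>\<Theta> \<in> Con A; a \<in> carrier A\<rbrakk> \<Longrightarrow> (a, a) \<in> \<Theta>"
  using Con_equiv unfolding equiv_def refl_on_def by blast

lemma Con_sym: "\<lbrakk>\<Theta> \<in> Con A; (a, b) \<in> \<Theta>\<rbrakk> \<Longrightarrow> (b, a) \<in> \<Theta>"
  using Con_equiv unfolding equiv_def sym_def by blast

lemma Con_trans: "\<lbrakk>\<Theta> \<in> Con A; (a, b) \<in> \<Theta>; (b, c) \<in> \<Theta>\<rbrakk> \<Longrightarrow> (a, c) \<in> \<Theta>"
  using Con_equiv unfolding equiv_def trans_def by blast

lemma Con_Int:
  assumes "\<Theta> \<in> Con A" and "\<Phi> \<in> Con A"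
  shows "\<Theta> \<inter> \<Phi> \<in> Con A"
proof (rule ConI)
  show "equiv (carrier A) (\<Theta> \<inter> \<Phi>)"
    using assms[THEN Con_equiv] unfolding equiv_def refl_on_def sym_def trans_def by blast
qed (use assms in \<open>auto intro: Con_join Con_tern Con_imp\<close>)

lemma Con_O_idem:
  assumes "\<Theta> \<in> Con A"
  shows "\<Theta> O \<Theta> = \<Theta>"
  using Con_trans[OF assms] Con_refl[OF assms] Con_carrier[OF assms] by fast

lemma Con_converse:
  assumes "\<Theta> \<in> Con A"
  shows "\<Theta>\<inverse> = \<Theta>"
  using Con_equiv[OF assms] unfolding equiv_def by (simp add: sym_conv_converse_eq)

text \<open>Only transitivity needs 3-permutability. Symmetry holds because the composition is a
  palindrome, and compatibility passes through the intermediate elements one by one.\<close>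

lemma Con_O_three:
  assumes perm: "three_permutable A" and \<Theta>: "\<Theta> \<in> Con A" and \<Phi>: "\<Phi> \<in> Con A"
  shows "\<Theta> O \<Phi> O \<Theta> \<in> Con A"
proof (rule ConI)
  have p: "\<Theta> O \<Phi> O \<Theta> = \<Phi> O \<Theta> O \<Phi>"
    using perm \<Theta> \<Phi> by (auto simp: three_permutable_def)
  note idem = Con_O_idem[OF \<Theta>] Con_O_idem[OF \<Phi>]
  \<comment> \<open>Merging the two middle factors leaves five. Exchanging the inner triple by
    \<open>p\<close> then puts equal factors side by side at both ends, where idempotence absorbs
    them.\<close>
  have "(\<Theta> O \<Phi> O \<Theta>) O (\<Theta> O \<Phi> O \<Theta>) = \<Theta> O (\<Phi> O \<Theta> O \<Phi>) O \<Theta>"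
    using idem by (metis O_assoc)
  also have "\<dots> = (\<Theta> O \<Theta>) O \<Phi> O (\<Theta> O \<Theta>)"
    by (simp only: p[symmetric]) (simp only: O_assoc)
  finally have "(\<Theta> O \<Phi> O \<Theta>) O (\<Theta> O \<Phi> O \<Theta>) \<subseteq> \<Theta> O \<Phi> O \<Theta>"
    by (simp only: idem subset_refl)
  then have "trans (\<Theta> O \<Phi> O \<Theta>)"
    by (meson relcompI subsetD transI)
  moreover have "sym (\<Theta> O \<Phi> O \<Theta>)"
    by (simp add: sym_conv_converse_eq converse_relcomp O_assoc Con_converse[OF \<Theta>]
        Con_converse[OF \<Phi>])
  moreover have "refl_on (carrier A) (\<Theta> O \<Phi> O \<Theta>)"
    using Con_refl[OF \<Theta>] Con_refl[OF \<Phi>] by (meson refl_onI relcompI)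
  moreover have "\<Theta> O \<Phi> O \<Theta> \<subseteq> carrier A \<times> carrier A"
    using Con_carrier[OF \<Theta>] by blast
  ultimately show "equiv (carrier A) (\<Theta> O \<Phi> O \<Theta>)"
    by (intro equivI)
next
  fix a a' b b' assume "(a, a') \<in> \<Theta> O \<Phi> O \<Theta>" and "(b, b') \<in> \<Theta> O \<Phi> O \<Theta>"
  then obtain s t u v where *: "(a, s) \<in> \<Theta>" "(s, t) \<in> \<Phi>" "(t, a') \<in> \<Theta>"
    "(b, u) \<in> \<Theta>" "(u, v) \<in> \<Phi>" "(v, b') \<in> \<Theta>"
    by (elim relcompEpair)
  show "(a \<curlyvee>\<^bsub>A\<^esub> b, a' \<curlyvee>\<^bsub>A\<^esub> b') \<in> \<Theta> O \<Phi> O \<Theta>"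
    by (rule relcompI[where b = "s \<curlyvee>\<^bsub>A\<^esub> u"], intro Con_join * \<Theta>,
        rule relcompI[where b = "t \<curlyvee>\<^bsub>A\<^esub> v"]) (intro Con_join * \<Theta> \<Phi>)+
  show "(a \<leadsto>\<^bsub>A\<^esub> b, a' \<leadsto>\<^bsub>A\<^esub> b') \<in> \<Theta> O \<Phi> O \<Theta>"
    by (rule relcompI[where b = "s \<leadsto>\<^bsub>A\<^esub> u"], intro Con_imp * \<Theta>,
        rule relcompI[where b = "t \<leadsto>\<^bsub>A\<^esub> v"]) (intro Con_imp * \<Theta> \<Phi>)+
  fix c c' assume "(c, c') \<in> \<Theta> O \<Phi> O \<Theta>"
  then obtain w x where **: "(c, w) \<in> \<Theta>" "(w, x) \<in> \<Phi>" "(x, c') \<in> \<Theta>"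
    by (elim relcompEpair)
  show "(\<^bold>r\<^bsub>A\<^esub> a b c, \<^bold>r\<^bsub>A\<^esub> a' b' c') \<in> \<Theta> O \<Phi> O \<Theta>"
    by (rule relcompI[where b = "\<^bold>r\<^bsub>A\<^esub> s u w"], intro Con_tern * ** \<Theta>,
        rule relcompI[where b = "\<^bold>r\<^bsub>A\<^esub> t v x"]) (intro Con_tern * ** \<Theta> \<Phi>)+
qed

section \<open>The lattice of congruences\<close>

lemma partial_order_Con_order: "partial_order (Con_order A)"
  by unfold_locales (auto simp: Con_order_def)

lemma greatest_Con_order:
  assumes "\<Theta> \<in> Con A" and "\<Phi> \<in> Con A"
  shows "greatest (Con_order A) (\<Theta> \<inter> \<Phi>) (Lower (Con_order A) {\<Theta>, \<Phi>})"
  by (rule greatest_LowerI) (use assms in \<open>auto simp: Con_order_def Lower_def Con_Int\<close>)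

text \<open>Padding with reflexive pairs places both congruences below the composition; any
  congruence above both absorbs it by transitivity.\<close>

lemma least_Con_order:
  assumes "three_permutable A" and \<Theta>: "\<Theta> \<in> Con A" and \<Phi>: "\<Phi> \<in> Con A"
  shows "least (Con_order A) (\<Theta> O \<Phi> O \<Theta>) (Upper (Con_order A) {\<Theta>, \<Phi>})"
proof (rule least_UpperI)
  fix \<Psi> assume "\<Psi> \<in> {\<Theta>, \<Phi>}"
  moreover have "(a, b) \<in> \<Theta> O \<Phi> O \<Theta>" if "(a, b) \<in> \<Theta> \<or> (a, b) \<in> \<Phi>" for a b
    using that by (meson relcompI Con_refl Con_carrier \<Theta> \<Phi>)
  ultimately show "\<Psi> \<sqsubseteq>\<^bsub>Con_order A\<^esub> \<Theta> O \<Phi> O \<Theta>"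
    by (auto simp: Con_order_def)
next
  fix \<Psi> assume "\<Psi> \<in> Upper (Con_order A) {\<Theta>, \<Phi>}"
  then have "\<Psi> \<in> Con A" "\<Theta> \<subseteq> \<Psi>" "\<Phi> \<subseteq> \<Psi>"
    using \<Theta> \<Phi> by (auto simp: Con_order_def Upper_def)
  then have "\<Theta> O \<Phi> O \<Theta> \<subseteq> \<Psi>"
    using Con_trans[of \<Psi>] by blast
  then show "\<Theta> O \<Phi> O \<Theta> \<sqsubseteq>\<^bsub>Con_order A\<^esub> \<Psi>"
    by (simp add: Con_order_def)
qed (use assms in \<open>auto simp: Con_order_def Con_O_three\<close>)

lemma lattice_Con_order:
  assumes "three_permutable A"
  shows "lattice (Con_order A)"
proof -
  interpret partial_order "Con_order A"
    by (rule partial_order_Con_order)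
  show ?thesis
  proof unfold_locales
    fix \<Theta> \<Phi> assume "\<Theta> \<in> carrier (Con_order A)" and "\<Phi> \<in> carrier (Con_order A)"
    then have "\<Theta> \<in> Con A" and "\<Phi> \<in> Con A"
      by (simp_all add: Con_order_def)
    then show "\<exists>\<Psi>. least (Con_order A) \<Psi> (Upper (Con_order A) {\<Theta>, \<Phi>})"
      and "\<exists>\<Psi>. greatest (Con_order A) \<Psi> (Lower (Con_order A) {\<Theta>, \<Phi>})"
      using least_Con_order[OF assms] greatest_Con_order by blast+
  qed
qed

text \<open>The library picks a meet by Hilbert choice, so uniqueness of greatest elements is what
  identifies it with the intersection.\<close>

lemma meet_Con_order:
  assumes "\<Theta> \<in> Con A" and "\<Phi> \<in> Con A"
  shows "\<Theta> \<sqinter>\<^bsub>Con_order A\<^esub> \<Phi> = \<Theta> \<inter> \<Phi>"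
  unfolding meet_def inf_def
  by (rule some_equality, rule greatest_Con_order[OF assms])
    (rule partial_order.greatest_unique[OF partial_order_Con_order _ greatest_Con_order[OF assms]])

lemma join_Con_order:
  assumes "three_permutable A" and "\<Theta> \<in> Con A" and "\<Phi> \<in> Con A"
  shows "\<Theta> \<squnion>\<^bsub>Con_order A\<^esub> \<Phi> = \<Theta> O \<Phi> O \<Theta>"
  unfolding join_def sup_def
  by (rule some_equality, rule least_Con_order[OF assms])
    (rule partial_order.least_unique[OF partial_order_Con_order _ least_Con_order[OF assms]])

section \<open>I-algebras\<close>

context I_algebra
begin

section \<open>Elementary identities of the operations\<close>

lemma le_antisym:
  assumes "x \<in> carrier A" and "y \<in> carrier A" and "x \<preceq> y" and "y \<preceq> x"
  shows "x = y"
  using assms join_comm unfolding ale_def by metis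

lemma join_one: "x \<in> carrier A \<Longrightarrow> x \<curlyvee> \<one> = \<one>"
  using le_one by (simp add: ale_def)

lemma tern_one:
  assumes "x \<in> carrier A" and "z \<in> carrier A"
  shows "\<^bold>r x \<one> z = x \<curlyvee> z"
  using I7[of x \<one> z] assms by (simp add: one_closed join_one)

lemma tern_same:
  assumes "x \<in> carrier A" and "z \<in> carrier A"
  shows "\<^bold>r x x z = x \<curlyvee> z"
  using I7[of x x z] assms by (simp add: join_idem)

text \<open>The value is squeezed between x, by \<open>I9\<close>, and the join of x with itself, by
  \<open>I5\<close>.\<close>

lemma tern_outer:
  assumes "x \<in> carrier A" and "u \<in> carrier A"
  shows "\<^bold>r x u x = x"
  using I5[of x u x] I9[of x u x] assms by (intro le_antisym) (simp_all add: join_idem tern_closed)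

lemma tern_right:
  assumes "x \<in> carrier A" and "z \<in> carrier A"
  shows "\<^bold>r x z z = z"
  using I6[of x z z] I9[of x z z] assms by (intro le_antisym) (simp_all add: join_idem tern_closed)

lemma imp_same:
  assumes x: "x \<in> carrier A"
  shows "x \<leadsto> x = \<one>"
proof (rule le_antisym)
  show "\<one> \<preceq> x \<leadsto> x"
    \<comment> \<open>With y = 1 and z = x, the right side of \<open>I4\<close> collapses to
      \<open>x \<leadsto> x\<close>, since r(x,1,x) = x.\<close>
    using I4[of x \<one> x] x by (simp add: one_closed join_idem tern_one)
qed (use x in \<open>simp_all add: imp_closed one_closed le_one\<close>)

section \<open>Weak regularity\<close>

lemma Con_join_if_imp_one:
  assumes \<Theta>: "\<Theta> \<in> Con A" and x: "x \<in> carrier A" and y: "y \<in> carrier A"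
    and "(x \<leadsto> y, \<one>) \<in> \<Theta>"
  shows "(y, x \<curlyvee> y) \<in> \<Theta>"
  \<comment> \<open>Apply r(x,_,y) to the given pair: \<open>I2\<close> evaluates the left end to y,
    \<open>tern_one\<close> the right end to \<open>x \<curlyvee> y\<close>.\<close>
  using Con_tern[OF \<Theta> Con_refl[OF \<Theta> x] assms(4) Con_refl[OF \<Theta> y]] x y
  by (simp add: I2 tern_one)

text \<open>For the backward direction, both elements are congruent to their common join. This
  describes a congruence entirely by its class of 1.\<close>

lemma Con_iff_imp_one:
  assumes \<Theta>: "\<Theta> \<in> Con A" and x: "x \<in> carrier A" and y: "y \<in> carrier A"
  shows "(x, y) \<in> \<Theta> \<longleftrightarrow> (x \<leadsto> y, \<one>) \<in> \<Theta> \<and> (y \<leadsto> x, \<one>) \<in> \<Theta>"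
proof
  assume xy: "(x, y) \<in> \<Theta>"
  show "(x \<leadsto> y, \<one>) \<in> \<Theta> \<and> (y \<leadsto> x, \<one>) \<in> \<Theta>"
    using Con_imp[OF \<Theta> xy Con_refl[OF \<Theta> y]] Con_imp[OF \<Theta> Con_sym[OF \<Theta> xy] Con_refl[OF \<Theta> x]]
    by (simp add: imp_same x y)
next
  assume "(x \<leadsto> y, \<one>) \<in> \<Theta> \<and> (y \<leadsto> x, \<one>) \<in> \<Theta>"
  then have "(y, x \<curlyvee> y) \<in> \<Theta>" and "(x, x \<curlyvee> y) \<in> \<Theta>"
    using Con_join_if_imp_one[OF \<Theta>] x y join_comm[OF x y] by metis+
  then show "(x, y) \<in> \<Theta>"
    using \<Theta> by (blast intro: Con_trans Con_sym)
qed

lemma weakly_regular: "weakly_regular A"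
  unfolding weakly_regular_def
proof (intro ballI impI)
  fix \<Theta> \<Phi> assume \<Theta>: "\<Theta> \<in> Con A" and \<Phi>: "\<Phi> \<in> Con A" and eq: "\<Theta> `` {\<one>} = \<Phi> `` {\<one>}"
  have "(a, \<one>) \<in> \<Theta> \<longleftrightarrow> (a, \<one>) \<in> \<Phi>" for a
    using eq Con_sym[OF \<Theta>] Con_sym[OF \<Phi>] by blast
  then have "(x, y) \<in> \<Theta> \<longleftrightarrow> (x, y) \<in> \<Phi>" if "x \<in> carrier A" "y \<in> carrier A" for x y
    using that by (simp add: Con_iff_imp_one \<Theta> \<Phi>)
  then show "\<Theta> = \<Phi>"
    using Con_carrier[OF \<Theta>] Con_carrier[OF \<Phi>] by (intro equalityI subrelI) blast+
qed

section \<open>3-permutability\<close>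

lemma three_permutable_subset:
  assumes \<Theta>: "\<Theta> \<in> Con A" and \<Phi>: "\<Phi> \<in> Con A"
  shows "\<Theta> O \<Phi> O \<Theta> \<subseteq> \<Phi> O \<Theta> O \<Phi>"
proof clarify
  fix a b c d assume ab: "(a, b) \<in> \<Theta>" and bc: "(b, c) \<in> \<Phi>" and cd: "(c, d) \<in> \<Theta>"
  note carr = Con_carrier[OF \<Theta> ab] Con_carrier[OF \<Theta> cd]
  note refls = Con_refl[OF \<Theta>] Con_refl[OF \<Phi>]
  define p where "p x y z = \<^bold>r z (y \<leadsto> x) x" for x y z
  have p_cong: "(p x y z, p x' y' z') \<in> \<Psi>"
    if "\<Psi> \<in> Con A" "(x, x') \<in> \<Psi>" "(y, y') \<in> \<Psi>" "(z, z') \<in> \<Psi>" for \<Psi> x y z x' y' z'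
    unfolding p_def using that by (blast intro: Con_tern Con_imp)
  \<comment> \<open>The first identity is \<open>I2\<close>; in the second the middle argument of r
    becomes 1.\<close>
  have p_right: "p x z z = x" and p_left: "p x x z = z \<curlyvee> x"
    if "x \<in> carrier A" "z \<in> carrier A" for x z
    using that by (simp_all add: p_def I2 imp_same tern_one)
  have "(p a b b, p a b c) \<in> \<Phi>"
    using bc carr by (intro p_cong \<Phi> refls)
  then have 1: "(a, p a b c) \<in> \<Phi>"
    by (simp add: p_right carr)
  \<comment> \<open>The inner endpoints \<open>p b b c\<close> and \<open>p c c b\<close> are both
    the join of b and c, so the two pairs can be chained.\<close>
  have "(p a b c, p b b c) \<in> \<Theta>" and "(p c c b, p d c b) \<in> \<Theta>"
    using ab cd carr by (auto intro!: p_cong \<Theta> refls)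
  then have 2: "(p a b c, p d c b) \<in> \<Theta>"
    by (metis Con_trans[OF \<Theta>] p_left join_comm carr)
  have "(p d c b, p d c c) \<in> \<Phi>"
    using bc carr by (intro p_cong \<Phi> refls)
  then have 3: "(p d c b, d) \<in> \<Phi>"
    by (simp add: p_right carr)
  show "(a, d) \<in> \<Phi> O \<Theta> O \<Phi>"
    using 1 2 3 by blast
qed

text \<open>The inclusion holds for every pair of congruences, so swapping them gives the reverse
  one.\<close>

lemma three_permutable: "three_permutable A"
  unfolding three_permutable_def by (simp add: three_permutable_subset subset_antisym)

section \<open>Congruence distributivity\<close>

lemma Con_join_right_Int_O:
  assumes \<Theta>: "\<Theta> \<in> Con A" and \<Phi>: "\<Phi> \<in> Con A" and \<Psi>: "\<Psi> \<in> Con A"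
    and xz: "(x, z) \<in> \<Theta>" and chain: "(x, z) \<in> \<Phi> O \<Psi> O \<Phi>"
  shows "(x \<curlyvee> z, z) \<in> (\<Theta> \<inter> \<Phi>) O (\<Theta> \<inter> \<Psi>) O (\<Theta> \<inter> \<Phi>)"
proof -
  from chain obtain u v where xu: "(x, u) \<in> \<Phi>" and uv: "(u, v) \<in> \<Psi>" and vz: "(v, z) \<in> \<Phi>"
    by blast
  have carr: "x \<in> carrier A" "u \<in> carrier A" "v \<in> carrier A" "z \<in> carrier A"
    using xu vz \<Phi> by (auto dest: Con_carrier)
  have step: "(\<^bold>r x s z, \<^bold>r x t z) \<in> \<Theta> \<inter> \<Omega>" if \<Omega>: "\<Omega> \<in> Con A" and st: "(s, t) \<in> \<Omega>" for s t \<Omega>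
  proof
    note st_carr = Con_carrier[OF \<Omega> st]
    \<comment> \<open>Replacing z by the \<Theta>-related x turns r(x,w,z) into r(x,w,x) = x,
      whatever w is; hence all such values share one \<Theta>-class.\<close>
    have "(\<^bold>r x w z, x) \<in> \<Theta>" if w: "w \<in> carrier A" for w
      using Con_tern[OF \<Theta> Con_refl[OF \<Theta> carr(1)] Con_refl[OF \<Theta> w] Con_sym[OF \<Theta> xz]]
      by (simp add: tern_outer carr w)
    then show "(\<^bold>r x s z, \<^bold>r x t z) \<in> \<Theta>"
      using st_carr \<Theta> by (blast intro: Con_trans Con_sym)
    show "(\<^bold>r x s z, \<^bold>r x t z) \<in> \<Omega>"
      using \<Omega> st carr by (intro Con_tern Con_refl)
  qed
  \<comment> \<open>The image of the chain x, u, v, z starts at r(x,x,z), which is the join rather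
    than x itself.\<close>
  have "(\<^bold>r x x z, \<^bold>r x z z) \<in> (\<Theta> \<inter> \<Phi>) O (\<Theta> \<inter> \<Psi>) O (\<Theta> \<inter> \<Phi>)"
    using step[OF \<Phi> xu] step[OF \<Psi> uv] step[OF \<Phi> vz] by blast
  then show ?thesis
    by (simp add: tern_same tern_right carr)
qed

lemma Con_Int_O_distrib:
  assumes \<Theta>: "\<Theta> \<in> Con A" and \<Phi>: "\<Phi> \<in> Con A" and \<Psi>: "\<Psi> \<in> Con A"
  shows "\<Theta> \<inter> (\<Phi> O \<Psi> O \<Phi>) = (\<Theta> \<inter> \<Phi>) O (\<Theta> \<inter> \<Psi>) O (\<Theta> \<inter> \<Phi>)" (is "?L = ?R")
proof
  have L: "?L \<in> Con A" and R: "?R \<in> Con A"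
    using assms by (simp_all add: Con_Int Con_O_three three_permutable)
  show "?L \<subseteq> ?R"
  proof (rule subrelI)
    fix x z assume xz: "(x, z) \<in> ?L"
    then have zx: "(z, x) \<in> ?L"
      by (rule Con_sym[OF L])
    \<comment> \<open>The chain from x to z and its reversal tie z and x to the same join; as
      \<open>?R\<close> is a congruence, x and z are then related.\<close>
    have "(x \<curlyvee> z, z) \<in> ?R" and "(z \<curlyvee> x, x) \<in> ?R"
      using xz zx Con_join_right_Int_O[OF assms] by blast+
    moreover have "z \<curlyvee> x = x \<curlyvee> z"
      using xz Con_carrier[OF L] join_comm by blast
    ultimately show "(x, z) \<in> ?R"
      using Con_trans[OF R Con_sym[OF R]] by metis
  qed
  show "?R \<subseteq> ?L"
    using Con_trans[OF \<Theta>] by blast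
qed

text \<open>Once meets are read as intersections and joins as triple compositions, the lattice law
  is exactly \<open>Con_Int_O_distrib\<close>.\<close>

lemma congruence_distributive: "congruence_distributive A"
  unfolding congruence_distributive_def distributive_lattice_def
proof (intro conjI ballI)
  show "lattice (Con_order A)"
    by (rule lattice_Con_order[OF three_permutable])
  fix \<Theta> \<Phi> \<Psi>
  assume "\<Theta> \<in> carrier (Con_order A)" "\<Phi> \<in> carrier (Con_order A)" "\<Psi> \<in> carrier (Con_order A)"
  then have "\<Theta> \<in> Con A" "\<Phi> \<in> Con A" "\<Psi> \<in> Con A"
    by (simp_all add: Con_order_def)
  then show "\<Theta> \<sqinter>\<^bsub>Con_order A\<^esub> (\<Phi> \<squnion>\<^bsub>Con_order A\<^esub> \<Psi>)
      = (\<Theta> \<sqinter>\<^bsub>Con_order A\<^esub> \<Phi>) \<squnion>\<^bsub>Con_order A\<^esub> (\<Theta> \<sqinter>\<^bsub>Con_order A\<^esub> \<Psi>)"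
    by (simp add: meet_Con_order join_Con_order three_permutable Con_Int Con_O_three
        Con_Int_O_distrib)
qed

end

theorem theorem5p5:
  shows "(\<forall>A \<in> (\<V> :: 'a alg2320 set). three_permutable A)
    \<and> (\<forall>A \<in> (\<V> :: 'a alg2320 set). congruence_distributive A)
    \<and> (\<forall>A \<in> (\<V> :: 'a alg2320 set). weakly_regular A)"
  by (simp add: I_algebras_def I_algebra.three_permutable I_algebra.congruence_distributive
      I_algebra.weakly_regular)

end
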